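(* Let Assumptions 1 and 2 of the context hold and let $x_0\in\mathsf X_0$. Let $\{\bar x_k,e_k^i,b_k^i,\ k\in\mathsf K,\ \bar\mu_k^i,\ k\in\mathsf K_l,\ i\in\mathsf N\}$ be a consistent solution of LCS2 (that is, a solution of LCS2 with parameters $\boldsymbol\mu^\star=\bar{\boldsymbol\mu}=\{\bar\mu_k^i\}$). For all $i\in\mathsf N$ construct the control sequence $$u_k^{i\star}=-(Y_k^i)^{-1}{B_k^i}'E_{k+1}^iA_k\bar x_k-b_k^i,\quad k\in\mathsf K_l,$$ and the co-state sequence $$\lambda_k^i:=E_k^i\bar x_k+e_k^i,\quad k\in\mathsf K.$$ Then the derived sequence $\{\bar x_k,\lambda_k^i,\ k\in\mathsf K,\ \bar\mu_k^i,\ k\in\mathsf K_l,\ i\in\mathsf N\}$ is a solution of LCS1 (with $x_k^\star=\bar x_k$ and $\mu_k^{i\star}=\bar\mu_k^i$).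
   Context: Notation. A prime denotes transpose; $\|a\|_A:=a'Aa$; $\mathrm{col}\{\cdot\}$ stacks vectors or matrices vertically; $0\le x\perp y\ge0$ means $x\ge0$, $y\ge0$ (componentwise) and $x'y=0$. $\mathsf N=\{1,\dots,N\}$ (players), $\mathsf K=\{0,\dots,K\}$, $\mathsf K_l=\mathsf K\setminus\{K\}$, $-i=\mathsf N\setminus\{i\}$. The game (DGC). The state $x_k\in\mathbb R^n$ evolves as $x_{k+1}=A_kx_k+\sum_{i\in\mathsf N}B_k^iu_k^i$, $k\in\mathsf K_l$, with given $x_0\in\mathbb R^n$, where $A_k\in\mathbb R^{n\times n}$, $B_k^i\in\mathbb R^{n\times m_i}$ and $u_k^i\in\mathbb R^{m_i}$ is player $i$'s action. Put $\mathsf u_k=\mathrm{col}\{u_k^i\}_{i=1}^N\in\mathbb R^m$, $m=\sum_im_i$. Player $i$'s constraints are $M_k^ix_k+N_k^i\mathsf u_k+r_k^i\ge0$, $k\in\mathsf K_l$, with $M_k^i\in\mathbb R^{c_i\times n}$, $N_k^i\in\mathbb R^{c_i\times m}$, $r_k^i\in\mathbb R^{c_i}$; $[N_k^i]_j\in\mathbb R^{c_i\times m_j}$ is the block of columns of $N_k^i$ multiplying $u_k^j$. Player $i$'s strategy is $\mathsf u^i=\mathrm{col}\{u_k^i\}_{k=0}^{K-1}$, and $\mathsf u^{-i}$ collects the strategies of the other players. Player $i$ minimizes $$J^i(\mathsf u^i,\mathsf u^{-i})=\tfrac12\|x_K\|_{Q_K^i}+{p_K^i}'x_K+\tfrac12\sum_{k\in\mathsf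 K_l}\Big(\|x_k\|_{Q_k^i}+2{p_k^i}'x_k+\sum_{j\in\mathsf N}\|u_k^j\|_{R_k^{ij}}\Big),$$ with $Q_k^i\in\mathbb R^{n\times n}$ symmetric, $p_k^i\in\mathbb R^n$, $R_k^{ij}\in\mathbb R^{m_j\times m_j}$, $R_k^{ii}$ symmetric. $R(x_0)$ is the set of joint strategies $(\mathsf u^i,\mathsf u^{-i})\in\mathbb R^{Km}$ for which, with the state generated from $x_0$, all players' constraints hold at all $k\in\mathsf K_l$; $\Omega=\{(x_0,(\mathsf u^i,\mathsf u^{-i})):(\mathsf u^i,\mathsf u^{-i})\in R(x_0)\}$; $\mathsf X_0=\{x_0\in\mathbb R^n: R(x_0)\ne\emptyset\}$. Assumption 1. (i) $\Omega\ne\emptyset$, and for every $x_0\in\mathsf X_0$, $R(x_0)$ is bounded. (ii) The matrices $[N_k^i]_i$, $k\in\mathsf K_l$, $i\in\mathsf N$, have full rank. (iii) The matrices $R_k^{ii}$, $k\in\mathsf K_l$, $i\in\mathsf N$, are positive definite. Assumption 2. For each $i\in\mathsf N$ the backward symmetric matrix Riccati equation $$E_k^i=A_k'E_{k+1}^iA_k+Q_k^i-A_k'E_{k+1}^iB_k^i(Y_k^i)^{-1}{B_k^i}'E_{k+1}^iA_k,\quad E_K^i=Q_K^i,$$ admits a solution $\{E_k^i,\ k\in\mathsf K\}$, and thus the matrices $Y_k^i=R_k^{ii}+{B_k^i}'E_{k+1}^iB_k^i$, $k\in\mathsf K_l$, $i\in\mathsf N$, are invertible. LCS1. A solution of LCS1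 is a collection $\{x_k^\star,\lambda_k^i\in\mathbb R^n,\ k\in\mathsf K,\ \mu_k^{i\star}\in\mathbb R^{c_i},\ k\in\mathsf K_l,\ i\in\mathsf N\}$ such that for all $k\in\mathsf K_l$, $i\in\mathsf N$ $$x_{k+1}^\star=A_kx_k^\star-\sum_{j\in\mathsf N}B_k^j(R_k^{jj})^{-1}\big({B_k^j}'\lambda_{k+1}^j-[N_k^j]_j'\mu_k^{j\star}\big),$$ $$\lambda_k^i=Q_k^ix_k^\star+p_k^i+A_k'\lambda_{k+1}^i-{M_k^i}'\mu_k^{i\star},$$ $$0\le M_k^ix_k^\star-\sum_{j\in\mathsf N}[N_k^i]_j(R_k^{jj})^{-1}\big({B_k^j}'\lambda_{k+1}^j-[N_k^j]_j'\mu_k^{j\star}\big)+r_k^i\ \perp\ \mu_k^{i\star}\ge0,$$ with $x_0^\star=x_0$ and $\lambda_K^i=Q_K^ix_K^\star+p_K^i$. LCS2. Let parameters $\boldsymbol\mu^\star=\{\mu_k^{i\star}\in\mathbb R^{c_i}\}$ be given. A solution of LCS2 with parameters $\boldsymbol\mu^\star$ is a collection $\{\bar x_k,e_k^i\in\mathbb R^n,\ b_k^i\in\mathbb R^{m_i},\ k\in\mathsf K,\ \bar\mu_k^i\in\mathbb R^{c_i},\ k\in\mathsf K_l,\ i\in\mathsf N\}$ such that for all $k\in\mathsf K_l$, $i\in\mathsf N$ $$\bar x_{k+1}=\big(\mathbf I-B_k^i(Y_k^i)^{-1}{B_k^i}'E_{k+1}^i\big)A_k\bar x_k-B_k^ib_k^i+B_k^i(Y_k^i)^{-1}\beta_k^i+\bar\eta_k^i,$$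 $$e_k^i=A_k'e_{k+1}^i+A_k'E_{k+1}^i\bar\eta_k^i-A_k'E_{k+1}^iB_k^ib_k^i+p_k^i-{M_k^i}'\mu_k^{i\star},$$ $$0\le[N_k^i]_i(Y_k^i)^{-1}\beta_k^i+\big(M_k^i-[N_k^i]_i(Y_k^i)^{-1}{B_k^i}'E_{k+1}^iA_k\big)\bar x_k-[N_k^i]_ib_k^i+\bar\alpha_k^i+r_k^i\ \perp\ \bar\mu_k^i\ge0,$$ $$Y_k^ib_k^i={B_k^i}'(E_{k+1}^i\bar\eta_k^i+e_{k+1}^i)-[N_k^i]_i'\mu_k^{i\star},$$ with $\bar x_0=x_0$, $e_K^i=p_K^i$, $b_K^i=0$, where $$\bar\eta_k^i=\sum_{j\in-i}B_k^j\bar u_k^j,\quad \bar\alpha_k^i=\sum_{j\in-i}[N_k^i]_j\bar u_k^j,\quad \bar u_k^i=-(Y_k^i)^{-1}{B_k^i}'E_{k+1}^iA_k\bar x_k-b_k^i+(Y_k^i)^{-1}\beta_k^i,$$ $$\beta_k^i=[N_k^i]_i'(\bar\mu_k^i-\mu_k^{i\star})+\sum_{\tau=k+1}^{K-1}(A_{\tau-1}\cdots A_{k+1}B_k^i)'{M_\tau^i}'(\bar\mu_\tau^i-\mu_\tau^{i\star})$$ (for $\tau=k+1$ the product $A_{\tau-1}\cdots A_{k+1}$ is the identity). The solution is called consistent if $\bar\mu_k^i=\mu_k^{i\star}$ for all $k\in\mathsf K_l$, $i\in\mathsf N$. *)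

theory Defs
  imports "Jordan_Normal_Form.DL_Rank" "Jordan_Normal_Form.Gauss_Jordan_Elimination"
begin

section \<open>Matrix preliminaries\<close>

text \<open>The inverse of an invertible matrix; unspecified otherwise.\<close>

definition mat_inv :: "real mat \<Rightarrow> real mat" where
  "mat_inv A = the (mat_inverse A)"

definition pos_definite :: "nat \<Rightarrow> real mat \<Rightarrow> bool" where
  "pos_definite d A \<longleftrightarrow> A \<in> carrier_mat d d \<and> A\<^sup>T = A \<and>
     (\<forall>v \<in> carrier_vec d. v \<noteq> 0\<^sub>v d \<longrightarrow> 0 < v \<bullet> (A *\<^sub>v v))"

definition full_rank :: "nat \<Rightarrow> nat \<Rightarrow> real mat \<Rightarrow> bool" where
  "full_rank nr nc A \<longleftrightarrow> A \<in> carrier_mat nr nc \<and> vec_space.rank nr A = min nr nc"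

definition quad :: "real vec \<Rightarrow> real mat \<Rightarrow> real" where
  "quad a A = a \<bullet> (A *\<^sub>v a)"

definition compl :: "nat \<Rightarrow> real vec \<Rightarrow> real vec \<Rightarrow> bool" where
  "compl d a b \<longleftrightarrow> 0\<^sub>v d \<le> a \<and> 0\<^sub>v d \<le> b \<and> a \<bullet> b = 0"

abbreviation vsum :: "nat \<Rightarrow> ('i \<Rightarrow> real vec) \<Rightarrow> 'i set \<Rightarrow> real vec" where
  "vsum d \<equiv> finsum_vec TYPE(real) d"

section \<open>The dynamic game with constraints\<close>

text \<open>
  Players are numbered \<open>1, \<dots>, nplayers G\<close>. Data depending on a player \<open>i\<close> and a stage \<open>k\<close>
  take the player first: \<open>Bmat G i k\<close> is the matrix $B_k^i$, and \<open>Rmat G i j k\<close> is $R_k^{ij}$.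
\<close>

record dgc =
  nplayers :: nat
  horizon :: nat
  sdim :: nat
  adim :: "nat \<Rightarrow> nat"
  cdim :: "nat \<Rightarrow> nat"
  Amat :: "nat \<Rightarrow> real mat"
  Bmat :: "nat \<Rightarrow> nat \<Rightarrow> real mat"
  Mmat :: "nat \<Rightarrow> nat \<Rightarrow> real mat"
  Nmat :: "nat \<Rightarrow> nat \<Rightarrow> real mat"
  rvec :: "nat \<Rightarrow> nat \<Rightarrow> real vec"
  Qmat :: "nat \<Rightarrow> nat \<Rightarrow> real mat"
  pvec :: "nat \<Rightarrow> nat \<Rightarrow> real vec"
  Rmat :: "nat \<Rightarrow> nat \<Rightarrow> nat \<Rightarrow> real mat"

definition players :: "dgc \<Rightarrow> nat set" where
  "players G = {1..nplayers G}"

definition total_adim :: "dgc \<Rightarrow> nat" where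
  "total_adim G = (\<Sum>i\<in>players G. adim G i)"

definition wf_dgc :: "dgc \<Rightarrow> bool" where
  "wf_dgc G \<longleftrightarrow>
     1 \<le> nplayers G \<and>
     (\<forall>k<horizon G. Amat G k \<in> carrier_mat (sdim G) (sdim G)) \<and>
     (\<forall>i\<in>players G. \<forall>k<horizon G.
        Bmat G i k \<in> carrier_mat (sdim G) (adim G i) \<and>
        Mmat G i k \<in> carrier_mat (cdim G i) (sdim G) \<and>
        Nmat G i k \<in> carrier_mat (cdim G i) (total_adim G) \<and>
        rvec G i k \<in> carrier_vec (cdim G i) \<and>
        (\<forall>j\<in>players G. Rmat G i j k \<in> carrier_mat (adim G j) (adim G j)) \<and>
        (Rmat G i i k)\<^sup>T = Rmat G i i k) \<and>
     (\<forall>i\<in>players G. \<forall>k\<le>horizon G.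
        Qmat G i k \<in> carrier_mat (sdim G) (sdim G) \<and>
        (Qmat G i k)\<^sup>T = Qmat G i k \<and>
        pvec G i k \<in> carrier_vec (sdim G))"

text \<open>The block $[N_k^i]_j$ of columns of $N_k^i$ multiplying $u_k^j$.\<close>

definition Nblock :: "dgc \<Rightarrow> nat \<Rightarrow> nat \<Rightarrow> nat \<Rightarrow> real mat" where
  "Nblock G i j k =
     mat (cdim G i) (adim G j) (\<lambda>(a, b). Nmat G i k $$ (a, (\<Sum>l\<in>{1..<j}. adim G l) + b))"

text \<open>A joint strategy is a function \<open>u\<close> with \<open>u i k\<close> the action of player \<open>i\<close> at stage \<open>k\<close>.
  Extensionality makes these functions correspond one-to-one to the stacked vectors.\<close>

definition joint_strategies :: "dgc \<Rightarrow> (nat \<Rightarrow> nat \<Rightarrow> real vec) set" where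
  "joint_strategies G =
     (\<Pi>\<^sub>E i\<in>players G. \<Pi>\<^sub>E k\<in>{..<horizon G}. carrier_vec (adim G i))"

definition stacked_action :: "dgc \<Rightarrow> (nat \<Rightarrow> nat \<Rightarrow> real vec) \<Rightarrow> nat \<Rightarrow> real vec" where
  "stacked_action G u k =
     vec_of_list (concat (map (\<lambda>i. list_of_vec (u i k)) [1..<Suc (nplayers G)]))"

primrec state :: "dgc \<Rightarrow> real vec \<Rightarrow> (nat \<Rightarrow> nat \<Rightarrow> real vec) \<Rightarrow> nat \<Rightarrow> real vec" where
  "state G x0 u 0 = x0"
| "state G x0 u (Suc k) =
     Amat G k *\<^sub>v state G x0 u k + vsum (sdim G) (\<lambda>i. Bmat G i k *\<^sub>v u i k) (players G)"

definition cost :: "dgc \<Rightarrow> real vec \<Rightarrow> nat \<Rightarrow> (nat \<Rightarrow> nat \<Rightarrow> real vec) \<Rightarrow> real" where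
  "cost G x0 i u =
     (let x = state G x0 u; K = horizon G in
      1/2 * quad (x K) (Qmat G i K) + pvec G i K \<bullet> x K +
      1/2 * (\<Sum>k<K. quad (x k) (Qmat G i k) + 2 * (pvec G i k \<bullet> x k) +
                     (\<Sum>j\<in>players G. quad (u j k) (Rmat G i j k))))"

definition feasible :: "dgc \<Rightarrow> real vec \<Rightarrow> (nat \<Rightarrow> nat \<Rightarrow> real vec) set" where
  "feasible G x0 = {u \<in> joint_strategies G. \<forall>i\<in>players G. \<forall>k<horizon G.
     0\<^sub>v (cdim G i) \<le> Mmat G i k *\<^sub>v state G x0 u k + Nmat G i k *\<^sub>v stacked_action G u k + rvec G i k}"

definition Omega :: "dgc \<Rightarrow> (real vec \<times> (nat \<Rightarrow> nat \<Rightarrow> real vec)) set" where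
  "Omega G = {(x0, u). x0 \<in> carrier_vec (sdim G) \<and> u \<in> feasible G x0}"

definition X0 :: "dgc \<Rightarrow> real vec set" where
  "X0 G = {x0 \<in> carrier_vec (sdim G). feasible G x0 \<noteq> {}}"

text \<open>Boundedness with respect to the Euclidean norm of the stacked strategy.\<close>

definition bounded_strategies :: "dgc \<Rightarrow> (nat \<Rightarrow> nat \<Rightarrow> real vec) set \<Rightarrow> bool" where
  "bounded_strategies G S \<longleftrightarrow>
     (\<exists>C. \<forall>u\<in>S. sqrt (\<Sum>i\<in>players G. \<Sum>k<horizon G. u i k \<bullet> u i k) \<le> C)"

definition assumption1 :: "dgc \<Rightarrow> bool" where
  "assumption1 G \<longleftrightarrow>
     Omega G \<noteq> {} \<and> (\<forall>x0\<in>X0 G. bounded_strategies G (feasible G x0)) \<and>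
     (\<forall>i\<in>players G. \<forall>k<horizon G. full_rank (cdim G i) (adim G i) (Nblock G i i k)) \<and>
     (\<forall>i\<in>players G. \<forall>k<horizon G. pos_definite (adim G i) (Rmat G i i k))"

definition Ymat :: "dgc \<Rightarrow> (nat \<Rightarrow> nat \<Rightarrow> real mat) \<Rightarrow> nat \<Rightarrow> nat \<Rightarrow> real mat" where
  "Ymat G E i k = Rmat G i i k + (Bmat G i k)\<^sup>T * E i (Suc k) * Bmat G i k"

abbreviation Yinv :: "dgc \<Rightarrow> (nat \<Rightarrow> nat \<Rightarrow> real mat) \<Rightarrow> nat \<Rightarrow> nat \<Rightarrow> real mat" where
  "Yinv G E i k \<equiv> mat_inv (Ymat G E i k)"

text \<open>\<open>E\<close> solves the backward Riccati equations, which includes that the matrices to be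
  inverted are invertible. Symmetry of \<open>E i k\<close> follows from that of the data.\<close>

definition riccati_solution :: "dgc \<Rightarrow> (nat \<Rightarrow> nat \<Rightarrow> real mat) \<Rightarrow> bool" where
  "riccati_solution G E \<longleftrightarrow>
     (\<forall>i\<in>players G.
        (\<forall>k\<le>horizon G. E i k \<in> carrier_mat (sdim G) (sdim G)) \<and>
        E i (horizon G) = Qmat G i (horizon G) \<and>
        (\<forall>k<horizon G.
           invertible_mat (Ymat G E i k) \<and>
           E i k = (Amat G k)\<^sup>T * E i (Suc k) * Amat G k + Qmat G i k
             - (Amat G k)\<^sup>T * E i (Suc k) * Bmat G i k * Yinv G E i k
                 * (Bmat G i k)\<^sup>T * E i (Suc k) * Amat G k))"

section \<open>The complementarity systems\<close>

text \<open>\<open>LCS1_action G lam mu j k\<close> is the vector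
  $-(R_k^{jj})^{-1}({B_k^j}'\lambda_{k+1}^j-[N_k^j]_j'\mu_k^j)$ occurring in LCS1.\<close>

definition LCS1_action ::
  "dgc \<Rightarrow> (nat \<Rightarrow> nat \<Rightarrow> real vec) \<Rightarrow> (nat \<Rightarrow> nat \<Rightarrow> real vec) \<Rightarrow> nat \<Rightarrow> nat \<Rightarrow> real vec" where
  "LCS1_action G lam mu j k =
     - (mat_inv (Rmat G j j k) *\<^sub>v
          ((Bmat G j k)\<^sup>T *\<^sub>v lam j (Suc k) - (Nblock G j j k)\<^sup>T *\<^sub>v mu j k))"

definition LCS1_solution ::
  "dgc \<Rightarrow> real vec \<Rightarrow> (nat \<Rightarrow> real vec) \<Rightarrow> (nat \<Rightarrow> nat \<Rightarrow> real vec) \<Rightarrow> (nat \<Rightarrow> nat \<Rightarrow> real vec)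
     \<Rightarrow> bool" where
  "LCS1_solution G x0 x lam mu \<longleftrightarrow>
     (let n = sdim G; K = horizon G; v = LCS1_action G lam mu in
     (\<forall>k\<le>K. x k \<in> carrier_vec n) \<and>
     (\<forall>i\<in>players G. \<forall>k\<le>K. lam i k \<in> carrier_vec n) \<and>
     (\<forall>i\<in>players G. \<forall>k<K. mu i k \<in> carrier_vec (cdim G i)) \<and>
     x 0 = x0 \<and>
     (\<forall>i\<in>players G. lam i K = Qmat G i K *\<^sub>v x K + pvec G i K) \<and>
     (\<forall>i\<in>players G. \<forall>k<K.
        x (Suc k) = Amat G k *\<^sub>v x k + vsum n (\<lambda>j. Bmat G j k *\<^sub>v v j k) (players G) \<and>
        lam i k = Qmat G i k *\<^sub>v x k + pvec G i k + (Amat G k)\<^sup>T *\<^sub>v lam i (Suc k)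
                    - (Mmat G i k)\<^sup>T *\<^sub>v mu i k \<and>
        compl (cdim G i)
          (Mmat G i k *\<^sub>v x k + vsum (cdim G i) (\<lambda>j. Nblock G i j k *\<^sub>v v j k) (players G)
             + rvec G i k)
          (mu i k)))"

text \<open>\<open>Aprod G s t\<close> is $A_{t-1}\cdots A_s$, the identity for \<open>t \<le> s\<close>.\<close>

primrec Aprod :: "dgc \<Rightarrow> nat \<Rightarrow> nat \<Rightarrow> real mat" where
  "Aprod G s 0 = 1\<^sub>m (sdim G)"
| "Aprod G s (Suc t) = (if t < s then 1\<^sub>m (sdim G) else Amat G t * Aprod G s t)"

definition beta ::
  "dgc \<Rightarrow> (nat \<Rightarrow> nat \<Rightarrow> real vec) \<Rightarrow> (nat \<Rightarrow> nat \<Rightarrow> real vec) \<Rightarrow> nat \<Rightarrow> nat \<Rightarrow> real vec" where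
  "beta G mus mu i k =
     (Nblock G i i k)\<^sup>T *\<^sub>v (mu i k - mus i k) +
     vsum (adim G i)
       (\<lambda>t. (Aprod G (Suc k) t * Bmat G i k)\<^sup>T *\<^sub>v ((Mmat G i t)\<^sup>T *\<^sub>v (mu i t - mus i t)))
       {Suc k..<horizon G}"

definition ubar ::
  "dgc \<Rightarrow> (nat \<Rightarrow> nat \<Rightarrow> real mat) \<Rightarrow> (nat \<Rightarrow> nat \<Rightarrow> real vec) \<Rightarrow> (nat \<Rightarrow> real vec)
     \<Rightarrow> (nat \<Rightarrow> nat \<Rightarrow> real vec) \<Rightarrow> (nat \<Rightarrow> nat \<Rightarrow> real vec) \<Rightarrow> nat \<Rightarrow> nat \<Rightarrow> real vec" where
  "ubar G E mus x b mu i k =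
     - ((Yinv G E i k * (Bmat G i k)\<^sup>T * E i (Suc k) * Amat G k) *\<^sub>v x k) - b i k
       + Yinv G E i k *\<^sub>v beta G mus mu i k"

definition LCS2_solution ::
  "dgc \<Rightarrow> (nat \<Rightarrow> nat \<Rightarrow> real mat) \<Rightarrow> real vec \<Rightarrow> (nat \<Rightarrow> nat \<Rightarrow> real vec)
     \<Rightarrow> (nat \<Rightarrow> real vec) \<Rightarrow> (nat \<Rightarrow> nat \<Rightarrow> real vec) \<Rightarrow> (nat \<Rightarrow> nat \<Rightarrow> real vec)
     \<Rightarrow> (nat \<Rightarrow> nat \<Rightarrow> real vec) \<Rightarrow> bool" where
  "LCS2_solution G E x0 mus x e b mu \<longleftrightarrow>
     (let n = sdim G; K = horizon G;
          eta = (\<lambda>i k. vsum n (\<lambda>j. Bmat G j k *\<^sub>v ubar G E mus x b mu j k) (players G - {i}));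
          alpha = (\<lambda>i k. vsum (cdim G i) (\<lambda>j. Nblock G i j k *\<^sub>v ubar G E mus x b mu j k)
                          (players G - {i}))
      in
     (\<forall>k\<le>K. x k \<in> carrier_vec n) \<and>
     (\<forall>i\<in>players G. \<forall>k\<le>K. e i k \<in> carrier_vec n \<and> b i k \<in> carrier_vec (adim G i)) \<and>
     (\<forall>i\<in>players G. \<forall>k<K. mu i k \<in> carrier_vec (cdim G i) \<and> mus i k \<in> carrier_vec (cdim G i)) \<and>
     x 0 = x0 \<and>
     (\<forall>i\<in>players G. e i K = pvec G i K \<and> b i K = 0\<^sub>v (adim G i)) \<and>
     (\<forall>i\<in>players G. \<forall>k<K.
        x (Suc k) =
          ((1\<^sub>m n - Bmat G i k * Yinv G E i k * (Bmat G i k)\<^sup>T * E i (Suc k)) * Amat G k) *\<^sub>v x k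
          - Bmat G i k *\<^sub>v b i k
          + (Bmat G i k * Yinv G E i k) *\<^sub>v beta G mus mu i k + eta i k \<and>
        e i k =
          (Amat G k)\<^sup>T *\<^sub>v e i (Suc k)
          + ((Amat G k)\<^sup>T * E i (Suc k)) *\<^sub>v eta i k
          - ((Amat G k)\<^sup>T * E i (Suc k) * Bmat G i k) *\<^sub>v b i k
          + pvec G i k - (Mmat G i k)\<^sup>T *\<^sub>v mus i k \<and>
        compl (cdim G i)
          ((Nblock G i i k * Yinv G E i k) *\<^sub>v beta G mus mu i k
           + (Mmat G i k
                - Nblock G i i k * Yinv G E i k * (Bmat G i k)\<^sup>T * E i (Suc k) * Amat G k) *\<^sub>v x k
           - Nblock G i i k *\<^sub>v b i k + alpha i k + rvec G i k)
          (mu i k) \<and>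
        Ymat G E i k *\<^sub>v b i k =
          (Bmat G i k)\<^sup>T *\<^sub>v (E i (Suc k) *\<^sub>v eta i k + e i (Suc k))
          - (Nblock G i i k)\<^sup>T *\<^sub>v mus i k))"

definition consistent_LCS2_solution ::
  "dgc \<Rightarrow> (nat \<Rightarrow> nat \<Rightarrow> real mat) \<Rightarrow> real vec \<Rightarrow> (nat \<Rightarrow> nat \<Rightarrow> real vec)
     \<Rightarrow> (nat \<Rightarrow> real vec) \<Rightarrow> (nat \<Rightarrow> nat \<Rightarrow> real vec) \<Rightarrow> (nat \<Rightarrow> nat \<Rightarrow> real vec)
     \<Rightarrow> (nat \<Rightarrow> nat \<Rightarrow> real vec) \<Rightarrow> bool" where
  "consistent_LCS2_solution G E x0 mus x e b mu \<longleftrightarrow>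
     LCS2_solution G E x0 mus x e b mu \<and>
     (\<forall>i\<in>players G. \<forall>k<horizon G. mu i k = mus i k)"

end

theory Submission
  imports Defs
begin

text \<open>
  Consistency makes \<open>\<beta>\<close> vanish, so that \<open>ubar\<close> is the affine feedback \<open>u\<^sub>k\<^sup>i\<close> and the state equation
  of LCS2 reads \<open>x\<^sub>k\<^sub>+\<^sub>1 = A x\<^sub>k + B\<^sup>i u\<^sup>i + \<eta>\<^sup>i\<close>. Applying \<open>Y\<close> to the feedback and substituting the
  equation for \<open>Y b\<close> gives \<open>B' \<lambda>\<^sub>k\<^sub>+\<^sub>1 - N' \<mu> = - R u\<close>, i.e. \<open>u\<close> is the action occurring in LCS1;
  the co-state equation is the sum of the Riccati equation, applied to \<open>x\<^sub>k\<close>, and the equation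
  for \<open>e\<^sub>k\<close>.
\<close>

section \<open>Matrix-vector algebra\<close>

text \<open>The hypotheses here and in the next rules are dimension equations instead of carrier
  memberships. No dimension occurs only in a premise, so the simplifier can discharge them by
  computing dimensions.\<close>

lemma mult_mat_vec_assoc:
  fixes A B :: "'a :: comm_ring_1 mat"
  assumes "dim_col A = dim_row B" "dim_col B = dim_vec v"
  shows "(A * B) *\<^sub>v v = A *\<^sub>v (B *\<^sub>v v)"
  using assms by (intro assoc_mult_mat_vec[of _ "dim_row A" "dim_row B" _ "dim_vec v"]) auto

lemma mult_mat_vec_add:
  fixes A :: "'a :: comm_ring_1 mat"
  assumes "dim_vec v = dim_col A" "dim_vec w = dim_col A"
  shows "A *\<^sub>v (v + w) = A *\<^sub>v v + A *\<^sub>v w"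
  using assms by (intro mult_add_distrib_mat_vec[of _ "dim_row A" "dim_col A"] carrier_vecI) auto

lemma mult_mat_vec_minus:
  fixes A :: "'a :: comm_ring_1 mat"
  assumes "dim_vec v = dim_col A" "dim_vec w = dim_col A"
  shows "A *\<^sub>v (v - w) = A *\<^sub>v v - A *\<^sub>v w"
  using assms by (intro mult_minus_distrib_mat_vec[of _ "dim_row A" "dim_col A"] carrier_vecI) auto

lemma mult_mat_vec_uminus:
  fixes A :: "'a :: comm_ring_1 mat"
  assumes "dim_vec v = dim_col A"
  shows "A *\<^sub>v (- v) = - (A *\<^sub>v v)"
  using assms by (intro eq_vecI) (auto simp: scalar_prod_def sum_negf)

lemma add_mult_mat_vec:
  fixes A B :: "'a :: comm_ring_1 mat"
  assumes "dim_row A = dim_row B" "dim_col A = dim_col B" "dim_vec v = dim_col B"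
  shows "(A + B) *\<^sub>v v = A *\<^sub>v v + B *\<^sub>v v"
  using assms by (intro add_mult_distrib_mat_vec[of _ "dim_row A" "dim_col A"] carrier_vecI) auto

lemma minus_mult_mat_vec:
  fixes A B :: "'a :: comm_ring_1 mat"
  assumes "dim_row A = dim_row B" "dim_col A = dim_col B" "dim_vec v = dim_col B"
  shows "(A - B) *\<^sub>v v = A *\<^sub>v v - B *\<^sub>v v"
  using assms by (intro minus_mult_distrib_mat_vec[of _ "dim_row A" "dim_col A"] carrier_vecI) auto

lemma mult_mat_zero_vec:
  fixes A :: "'a :: comm_ring_1 mat"
  assumes "dim_col A = n"
  shows "A *\<^sub>v 0\<^sub>v n = 0\<^sub>v (dim_row A)"
  using assms by (intro eq_vecI) auto

lemma one_mult_mat_vec_dim: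
  fixes v :: "'a :: comm_ring_1 vec"
  assumes "dim_vec v = n"
  shows "1\<^sub>m n *\<^sub>v v = v"
  using assms by (intro one_mult_mat_vec carrier_vecI)

text \<open>As rewrite rules these turn products and sums of matrices applied to a vector into sums
  of nested matrix-vector products, a common normal form for both sides of an identity.\<close>

lemmas mat_vec_algebra =
  mult_mat_vec_assoc mult_mat_vec_add mult_mat_vec_minus mult_mat_vec_uminus
  add_mult_mat_vec minus_mult_mat_vec mult_mat_zero_vec one_mult_mat_vec_dim

section \<open>Inverses of square matrices\<close>

lemma mat_inv_works:
  assumes "A \<in> carrier_mat d d" "invertible_mat A"
  shows "mat_inv A \<in> carrier_mat d d" "A * mat_inv A = 1\<^sub>m d" "mat_inv A * A = 1\<^sub>m d"
proof -
  obtain B where AB: "inverts_mat A B" and BA: "inverts_mat B A"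
    using assms(2) unfolding invertible_mat_def by blast
  have eqs: "A * B = 1\<^sub>m d" "B * A = 1\<^sub>m (dim_row B)"
    using AB BA assms(1) unfolding inverts_mat_def by auto
  \<comment> \<open>The witness \<open>B\<close> comes without a shape; comparing the column counts
    in both product equations makes it \<open>d\<close> by \<open>d\<close>.\<close>
  have "dim_col B = d" "dim_row B = d"
    using arg_cong[OF eqs(1), of dim_col] arg_cong[OF eqs(2), of dim_col] assms(1) by auto
  then have "A \<in> Units (ring_mat TYPE(real) d ())"
    using eqs assms(1) unfolding Units_def ring_mat_def by auto
  \<comment> \<open>\<open>mat_inverse\<close> returns \<open>None\<close> only for non-units, so
    \<open>the\<close> in \<open>mat_inv\<close> is applied to a genuine value.\<close>
  then obtain C where C: "mat_inverse A = Some C"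
    using mat_inverse(1)[OF assms(1), of "()"] by (cases "mat_inverse A") auto
  show "mat_inv A \<in> carrier_mat d d" "A * mat_inv A = 1\<^sub>m d" "mat_inv A * A = 1\<^sub>m d"
    using mat_inverse(2)[OF assms(1) C] C unfolding mat_inv_def by auto
qed

text \<open>A zero determinant would give a nonzero \<open>v\<close> with \<open>A v = 0\<close>,
  hence a quadratic form vanishing at \<open>v\<close>.\<close>

lemma pos_definite_invertible:
  assumes "pos_definite d A"
  shows "invertible_mat A"
proof -
  have A: "A \<in> carrier_mat d d"
    using assms unfolding pos_definite_def by blast
  have "det A \<noteq> 0"
  proof
    assume "det A = 0"
    then obtain v where "v \<in> carrier_vec d" "v \<noteq> 0\<^sub>v d" "A *\<^sub>v v = 0\<^sub>v d"
      using det_0_iff_vec_prod_zero_field[OF A] by blast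
    then show False
      using assms unfolding pos_definite_def by fastforce
  qed
  then show ?thesis
    using det_non_zero_imp_unit[OF A, of "()"] A
    unfolding invertible_mat_def inverts_mat_def Units_def ring_mat_def by auto
qed

section \<open>Finite sums of vectors\<close>

lemma vsum_cong:
  assumes "\<And>j. j \<in> P \<Longrightarrow> g j \<in> carrier_vec d" "\<And>j. j \<in> P \<Longrightarrow> f j = g j"
  shows "vsum d f P = vsum d g P"
  unfolding finsum_vec_def
  by (rule comm_monoid.finprod_cong'[OF comm_monoid_vec])
    (use assms in \<open>auto simp: monoid_vec_simps\<close>)

lemma vsum_zero:
  assumes "\<And>j. j \<in> P \<Longrightarrow> f j = 0\<^sub>v d"
  shows "vsum d f P = 0\<^sub>v d"
  unfolding finsum_vec_def
  using comm_monoid.finprod_one_eqI[OF comm_monoid_vec, of P f d] assms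
  by (simp add: monoid_vec_simps)

lemma vsum_remove:
  assumes "finite P" "i \<in> P" "\<And>j. j \<in> P \<Longrightarrow> f j \<in> carrier_vec d"
  shows "vsum d f P = f i + vsum d f (P - {i})"
proof -
  have "vsum d f (insert i (P - {i})) = f i + vsum d f (P - {i})"
    by (rule finsum_vec_insert) (use assms in auto)
  then show ?thesis
    using assms(2) by (simp add: insert_absorb)
qed

section \<open>The feedback at one stage\<close>

text \<open>One player at one stage \<open>k\<close>, with all indices dropped. \<open>E\<close> and
  \<open>e\<close> stand for the data at stage \<open>k + 1\<close>, the other vectors for those at
  stage \<open>k\<close>; \<open>eta\<close> is the joint effect of the other players on the
  state.\<close>

locale riccati_stage =
  fixes n m c :: nat and A B E Q R Y M N :: "real mat" and x e b eta p mu u :: "real vec"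
  assumes mats: "A \<in> carrier_mat n n" "B \<in> carrier_mat n m" "E \<in> carrier_mat n n"
      "Q \<in> carrier_mat n n" "R \<in> carrier_mat m m" "M \<in> carrier_mat c n" "N \<in> carrier_mat c m"
    and vecs: "x \<in> carrier_vec n" "e \<in> carrier_vec n" "b \<in> carrier_vec m"
      "eta \<in> carrier_vec n" "p \<in> carrier_vec n" "mu \<in> carrier_vec c"
    and Y_def: "Y = R + B\<^sup>T * E * B"
    and Y_inv: "invertible_mat Y"
    and R_inv: "invertible_mat R"
    and u_def: "u = - ((mat_inv Y * B\<^sup>T * E * A) *\<^sub>v x) - b"
begin

lemma Y_carrier: "Y \<in> carrier_mat m m"
  unfolding Y_def using mats by auto

lemmas Yinv = mat_inv_works[OF Y_carrier Y_inv]

lemma u_carrier: "u \<in> carrier_vec m"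
  unfolding u_def using mats vecs carrier_matD[OF Yinv(1)] by (intro carrier_vecI) auto

lemmas dims = mats[THEN carrier_matD(1)] mats[THEN carrier_matD(2)] vecs[THEN carrier_vecD]
  carrier_matD[OF Y_carrier] carrier_matD[OF Yinv(1)] carrier_vecD[OF u_carrier]

lemma Y_u: "Y *\<^sub>v u = - (B\<^sup>T *\<^sub>v (E *\<^sub>v (A *\<^sub>v x))) - Y *\<^sub>v b"
proof -
  have "Y *\<^sub>v u = - ((Y * mat_inv Y) *\<^sub>v (B\<^sup>T *\<^sub>v (E *\<^sub>v (A *\<^sub>v x)))) - Y *\<^sub>v b"
    unfolding u_def by (simp add: mat_vec_algebra dims)
  then show ?thesis
    by (simp add: Yinv(2) one_mult_mat_vec_dim dims)
qed

text \<open>The zero vector occupies the place of \<open>beta\<close> in the LCS2 state equation, so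
  the left side matches that equation once \<open>beta\<close> is replaced by zero.\<close>

lemma next_state:
  "((1\<^sub>m n - B * mat_inv Y * B\<^sup>T * E) * A) *\<^sub>v x - B *\<^sub>v b + (B * mat_inv Y) *\<^sub>v 0\<^sub>v m + eta
     = A *\<^sub>v x + (B *\<^sub>v u + eta)"
  unfolding u_def
  \<comment> \<open>With \<open>index_mult_mat_vec\<close> removed, entries of matrix-vector
    products remain atoms, and each index leaves a linear identity between reals.\<close>
  by (intro eq_vecI) (simp_all add: mat_vec_algebra dims del: index_mult_mat_vec)

text \<open>Since \<open>Y = R + B' E B\<close>, the vector \<open>Y u\<close> is \<open>R u\<close>
  plus the term by which the player's own action enters through the next state. Equating this with
  \<open>Y_u\<close> and eliminating \<open>Y b\<close> by the assumption leaves
  \<open>- R u\<close> inside the bracket, and \<open>mat_inv R\<close> cancels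
  \<open>R\<close>.\<close>

lemma action:
  assumes "Y *\<^sub>v b = B\<^sup>T *\<^sub>v (E *\<^sub>v eta + e) - N\<^sup>T *\<^sub>v mu"
  shows "- (mat_inv R *\<^sub>v (B\<^sup>T *\<^sub>v (E *\<^sub>v (A *\<^sub>v x + (B *\<^sub>v u + eta)) + e) - N\<^sup>T *\<^sub>v mu)) = u"
proof -
  note Rinv = mat_inv_works[OF mats(5) R_inv]
  have Yu: "Y *\<^sub>v u = R *\<^sub>v u + B\<^sup>T *\<^sub>v (E *\<^sub>v (B *\<^sub>v u))"
    unfolding Y_def by (simp add: mat_vec_algebra dims)
  have "B\<^sup>T *\<^sub>v (E *\<^sub>v (A *\<^sub>v x + (B *\<^sub>v u + eta)) + e) - N\<^sup>T *\<^sub>v mu = - (R *\<^sub>v u)"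
  proof (intro eq_vecI)
    fix a assume "a < dim_vec (- (R *\<^sub>v u))"
    then have a: "a < m"
      by (simp add: dims)
    show "(B\<^sup>T *\<^sub>v (E *\<^sub>v (A *\<^sub>v x + (B *\<^sub>v u + eta)) + e) - N\<^sup>T *\<^sub>v mu) $ a = (- (R *\<^sub>v u)) $ a"
      using arg_cong[OF trans[OF Yu[symmetric] Y_u], of "\<lambda>v. v $ a"] arg_cong[OF assms, of "\<lambda>v. v $ a"] a
      by (simp add: mat_vec_algebra dims del: index_mult_mat_vec)
  qed (simp add: dims)
  then have "- (mat_inv R *\<^sub>v (B\<^sup>T *\<^sub>v (E *\<^sub>v (A *\<^sub>v x + (B *\<^sub>v u + eta)) + e) - N\<^sup>T *\<^sub>v mu))
      = (mat_inv R * R) *\<^sub>v u"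
    using Rinv(1) by (simp add: mat_vec_algebra dims)
  then show ?thesis
    by (simp add: Rinv(3) one_mult_mat_vec_dim dims)
qed

text \<open>The left side is the Riccati expression applied to \<open>x\<close> plus the LCS2
  expression for \<open>e\<close> at stage \<open>k\<close>. Expanding \<open>u\<close> on the right
  produces exactly the terms of the left in \<open>mat_inv Y\<close> and in
  \<open>b\<close>.\<close>

lemma costate:
  "(A\<^sup>T * E * A + Q - A\<^sup>T * E * B * mat_inv Y * B\<^sup>T * E * A) *\<^sub>v x
     + (A\<^sup>T *\<^sub>v e + (A\<^sup>T * E) *\<^sub>v eta - (A\<^sup>T * E * B) *\<^sub>v b + p - M\<^sup>T *\<^sub>v mu)
   = Q *\<^sub>v x + p + A\<^sup>T *\<^sub>v (E *\<^sub>v (A *\<^sub>v x + (B *\<^sub>v u + eta)) + e) - M\<^sup>T *\<^sub>v mu"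
  unfolding u_def
  by (intro eq_vecI) (simp_all add: mat_vec_algebra dims del: index_mult_mat_vec)

lemma constraint:
  assumes "alpha \<in> carrier_vec c" "r \<in> carrier_vec c"
  shows "(N * mat_inv Y) *\<^sub>v 0\<^sub>v m + (M - N * mat_inv Y * B\<^sup>T * E * A) *\<^sub>v x - N *\<^sub>v b + alpha + r
     = M *\<^sub>v x + (N *\<^sub>v u + alpha) + r"
  unfolding u_def
  by (intro eq_vecI)
    (simp_all add: mat_vec_algebra dims assms[THEN carrier_vecD] del: index_mult_mat_vec)

end

section \<open>Consistent solutions of LCS2\<close>

text \<open>The bound on \<open>t\<close> reflects that \<open>wf_dgc\<close> fixes the shape of
  \<open>Amat G k\<close> only below the horizon.\<close>

lemma Aprod_carrier:
  assumes "wf_dgc G" "t \<le> horizon G"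
  shows "Aprod G s t \<in> carrier_mat (sdim G) (sdim G)"
  using assms(2)
proof (induction t)
  case (Suc t)
  have "Amat G t \<in> carrier_mat (sdim G) (sdim G)"
    using assms(1) Suc.prems unfolding wf_dgc_def by auto
  then show ?case
    using Suc by auto
qed simp

lemma Nblock_carrier [simp]: "Nblock G i j k \<in> carrier_mat (cdim G i) (adim G j)"
  unfolding Nblock_def by simp

text \<open>Every summand of \<open>beta\<close> is a matrix applied to a difference of
  \<open>mu\<close> and \<open>mus\<close> at a stage below the horizon, and those differences
  vanish.\<close>

lemma beta_consistent:
  assumes wf: "wf_dgc G" and i: "i \<in> players G" and k: "k < horizon G"
    and mu: "\<And>t. t < horizon G \<Longrightarrow> mu i t \<in> carrier_vec (cdim G i)"
    and eq: "\<And>t. t < horizon G \<Longrightarrow> mu i t = mus i t"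
  shows "beta G mus mu i k = 0\<^sub>v (adim G i)"
proof -
  have diff: "mu i t - mus i t = 0\<^sub>v (cdim G i)" if "t < horizon G" for t
    using mu[OF that] eq[OF that, symmetric] by simp
  have "vsum (adim G i)
      (\<lambda>t. (Aprod G (Suc k) t * Bmat G i k)\<^sup>T *\<^sub>v ((Mmat G i t)\<^sup>T *\<^sub>v (mu i t - mus i t)))
      {Suc k..<horizon G} = 0\<^sub>v (adim G i)"
  proof -
    have "(Aprod G (Suc k) t * Bmat G i k)\<^sup>T *\<^sub>v ((Mmat G i t)\<^sup>T *\<^sub>v (mu i t - mus i t))
        = 0\<^sub>v (adim G i)" if "t \<in> {Suc k..<horizon G}" for t
    proof -
      have "Mmat G i t \<in> carrier_mat (cdim G i) (sdim G)"
        "Bmat G i k \<in> carrier_mat (sdim G) (adim G i)"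
        using wf i k that unfolding wf_dgc_def by auto
      moreover have "Aprod G (Suc k) t \<in> carrier_mat (sdim G) (sdim G)"
        using Aprod_carrier[OF wf] that by auto
      ultimately show ?thesis
        using that by (auto simp: diff mult_mat_zero_vec)
    qed
    then show ?thesis
      by (rule vsum_zero)
  qed
  then show ?thesis
    unfolding beta_def diff[OF k] by (simp add: mult_mat_zero_vec carrier_matD[OF Nblock_carrier])
qed

theorem theorem3:
  fixes G :: dgc
    and E :: "nat \<Rightarrow> nat \<Rightarrow> real mat"
    and x0 :: "real vec"
    and x :: "nat \<Rightarrow> real vec"
    and e b mu mus u lam :: "nat \<Rightarrow> nat \<Rightarrow> real vec"
  assumes "wf_dgc G"
    and "assumption1 G"
    and "riccati_solution G E"
    and "x0 \<in> X0 G"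
    and "consistent_LCS2_solution G E x0 mus x e b mu"
    and "\<And>i k. i \<in> players G \<Longrightarrow> k < horizon G \<Longrightarrow>
           u i k = - ((Yinv G E i k * (Bmat G i k)\<^sup>T * E i (Suc k) * Amat G k) *\<^sub>v x k) - b i k"
    and "\<And>i k. i \<in> players G \<Longrightarrow> k \<le> horizon G \<Longrightarrow> lam i k = E i k *\<^sub>v x k + e i k"
  shows "LCS1_solution G x0 x lam mu"
proof -
  note wf = assms(1) and u = assms(6) and lam = assms(7)
  define n where "n = sdim G"
  define K where "K = horizon G"
  define P where "P = players G"
  have fin: "finite P"
    unfolding P_def players_def by simp
  define ub where "ub = ubar G E mus x b mu"
  define eta where "eta i k = vsum n (\<lambda>j. Bmat G j k *\<^sub>v ub j k) (P - {i})" for i k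
  define alpha where
    "alpha i k = vsum (cdim G i) (\<lambda>j. Nblock G i j k *\<^sub>v ub j k) (P - {i})" for i k
  have sol: "LCS2_solution G E x0 mus x e b mu"
    and mueq: "\<And>i k. i \<in> P \<Longrightarrow> k < K \<Longrightarrow> mu i k = mus i k"
    using assms(5) unfolding consistent_LCS2_solution_def P_def K_def by auto
  note LCS2 = sol[unfolded LCS2_solution_def Let_def, folded n_def K_def P_def ub_def,
      folded eta_def alpha_def]
  \<comment> \<open>The five projections skip the carrier and boundary conditions and leave the
    stage equations.\<close>
  note LCS2_step = LCS2[THEN conjunct2, THEN conjunct2, THEN conjunct2, THEN conjunct2,
      THEN conjunct2, rule_format]
  have xc: "x k \<in> carrier_vec n" if "k \<le> K" for k
    using LCS2 that by blast
  have ec: "e i k \<in> carrier_vec n" and bc: "b i k \<in> carrier_vec (adim G i)"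
    if "i \<in> P" "k \<le> K" for i k
    using LCS2 that by blast+
  have muc: "mu i k \<in> carrier_vec (cdim G i)" if "i \<in> P" "k < K" for i k
    using LCS2 that by blast
  have Ec: "E i k \<in> carrier_mat n n" if "i \<in> P" "k \<le> K" for i k
    using assms(3) that unfolding riccati_solution_def P_def K_def n_def by blast
  have beta: "beta G mus mu i k = 0\<^sub>v (adim G i)" if "i \<in> P" "k < K" for i k
    using that muc mueq unfolding P_def K_def by (intro beta_consistent[OF wf]) auto
  have mats: "Amat G k \<in> carrier_mat n n" "Bmat G i k \<in> carrier_mat n (adim G i)"
    "Mmat G i k \<in> carrier_mat (cdim G i) n" "rvec G i k \<in> carrier_vec (cdim G i)"
    "Rmat G i i k \<in> carrier_mat (adim G i) (adim G i)"
    "Qmat G i k \<in> carrier_mat n n" "pvec G i k \<in> carrier_vec n" if "i \<in> P" "k < K" for i k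
    using wf that unfolding wf_dgc_def P_def K_def n_def by auto
  have Yinv: "invertible_mat (Ymat G E i k)" if "i \<in> P" "k < K" for i k
    using assms(3) that unfolding riccati_solution_def P_def K_def by blast
  have Rinv: "invertible_mat (Rmat G i i k)" if "i \<in> P" "k < K" for i k
    using assms(2) that pos_definite_invertible
    unfolding assumption1_def P_def K_def by blast
  have Yc: "Ymat G E i k \<in> carrier_mat (adim G i) (adim G i)" if "i \<in> P" "k < K" for i k
    using mats[OF that] Ec[of i "Suc k"] that unfolding Ymat_def by auto
  \<comment> \<open>The premises on \<open>i\<close> and \<open>k\<close> arise once from
    \<open>Yc\<close> and once from \<open>Yinv\<close>, hence the later
    \<open>OF that that\<close>.\<close>
  note Yinvc = mat_inv_works(1)[OF Yc Yinv]
  have uc: "u i k \<in> carrier_vec (adim G i)" if "i \<in> P" "k < K" for i k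
    using u[of i k] that carrier_matD[OF Yinvc[OF that that]] bc[of i k]
    unfolding P_def K_def by (intro carrier_vecI) simp
  have ub_u: "ub i k = u i k" if "i \<in> P" "k < K" for i k
  proof -
    \<comment> \<open>The zero vector is what remains of the \<open>beta\<close> term; dropping it
      requires the dimension of \<open>u i k\<close>.\<close>
    have "ub i k = u i k + 0\<^sub>v (adim G i)"
      using that u[of i k] beta[OF that] Yinvc[OF that that]
      unfolding ub_def ubar_def P_def K_def by (simp add: mult_mat_zero_vec)
    then show ?thesis
      using uc[OF that] by simp
  qed
  have etac: "eta i k \<in> carrier_vec n" and alphac: "alpha i k \<in> carrier_vec (cdim G i)"
    if "k < K" for i k
  proof -
    have ubc: "ub j k \<in> carrier_vec (adim G j)" if "j \<in> P" for j
      unfolding ub_u[OF that \<open>k < K\<close>] by (rule uc[OF that \<open>k < K\<close>])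
    show "eta i k \<in> carrier_vec n" "alpha i k \<in> carrier_vec (cdim G i)"
      unfolding eta_def alpha_def
      by (intro finsum_vec_closed Pi_I mult_mat_vec_carrier[OF mats(2) ubc]
          mult_mat_vec_carrier[OF Nblock_carrier ubc]; use that in simp)+
  qed
  \<comment> \<open>\<open>k < K\<close> gives \<open>Suc k \<le> K\<close>, so the shifted
    \<open>E\<close> and \<open>e\<close> have the required shapes.\<close>
  have stage: "riccati_stage n (adim G i) (cdim G i) (Amat G k) (Bmat G i k) (E i (Suc k))
      (Qmat G i k) (Rmat G i i k) (Ymat G E i k) (Mmat G i k) (Nblock G i i k) (x k)
      (e i (Suc k)) (b i k) (eta i k) (pvec G i k) (mu i k) (u i k)"
    if "i \<in> P" "k < K" for i k
    using that
    by (intro riccati_stage.intro mats Nblock_carrier Ec xc ec bc etac muc Yinv Rinv Ymat_def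
        u[folded P_def K_def]) simp_all
  \<comment> \<open>Each player has its own form of the state equation, with the own action split
    off from \<open>eta\<close>; all describe the same trajectory.\<close>
  have state: "x (Suc k) = Amat G k *\<^sub>v x k + (Bmat G i k *\<^sub>v u i k + eta i k)"
    if "i \<in> P" "k < K" for i k
  proof -
    have "x (Suc k) =
        ((1\<^sub>m n - Bmat G i k * Yinv G E i k * (Bmat G i k)\<^sup>T * E i (Suc k)) * Amat G k) *\<^sub>v x k
        - Bmat G i k *\<^sub>v b i k
        + (Bmat G i k * Yinv G E i k) *\<^sub>v beta G mus mu i k + eta i k"
      by (rule LCS2_step[OF that, THEN conjunct1])
    then show ?thesis
      unfolding beta[OF that] riccati_stage.next_state[OF stage[OF that]] .
  qed
  have act: "LCS1_action G lam mu i k = u i k" if "i \<in> P" "k < K" for i k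
  proof -
    have "Ymat G E i k *\<^sub>v b i k =
        (Bmat G i k)\<^sup>T *\<^sub>v (E i (Suc k) *\<^sub>v eta i k + e i (Suc k)) - (Nblock G i i k)\<^sup>T *\<^sub>v mu i k"
      unfolding mueq[OF that]
      by (rule LCS2_step[OF that, THEN conjunct2, THEN conjunct2, THEN conjunct2])
    from riccati_stage.action[OF stage[OF that] this] show ?thesis
      using lam[of i "Suc k"] that state[OF that]
      unfolding LCS1_action_def P_def K_def by simp
  qed
  \<comment> \<open>LCS1 sums over all players, LCS2 over the opponents of \<open>i\<close>. By
    \<open>act\<close> and \<open>ub_u\<close> both use the same actions, so splitting off the
    summand \<open>i\<close> reconciles the two.\<close>
  have sumB: "vsum n (\<lambda>j. Bmat G j k *\<^sub>v LCS1_action G lam mu j k) P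
      = Bmat G i k *\<^sub>v u i k + eta i k"
    and sumN: "vsum (cdim G i) (\<lambda>j. Nblock G i j k *\<^sub>v LCS1_action G lam mu j k) P
      = Nblock G i i k *\<^sub>v u i k + alpha i k" if "i \<in> P" "k < K" for i k
  proof -
    have B: "Bmat G j k *\<^sub>v u j k \<in> carrier_vec n" if "j \<in> P" for j
      using mats(2)[OF that \<open>k < K\<close>] uc[OF that \<open>k < K\<close>] by (rule mult_mat_vec_carrier)
    have N: "Nblock G i j k *\<^sub>v u j k \<in> carrier_vec (cdim G i)" if "j \<in> P" for j
      using Nblock_carrier uc[OF that \<open>k < K\<close>] by (rule mult_mat_vec_carrier)
    have "vsum n (\<lambda>j. Bmat G j k *\<^sub>v LCS1_action G lam mu j k) (P - {i}) = eta i k"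
      unfolding eta_def using B act ub_u that by (intro vsum_cong) auto
    then show "vsum n (\<lambda>j. Bmat G j k *\<^sub>v LCS1_action G lam mu j k) P
        = Bmat G i k *\<^sub>v u i k + eta i k"
      using vsum_remove[OF fin that(1), of "\<lambda>j. Bmat G j k *\<^sub>v LCS1_action G lam mu j k" n]
        B act that by simp
    have "vsum (cdim G i) (\<lambda>j. Nblock G i j k *\<^sub>v LCS1_action G lam mu j k) (P - {i}) = alpha i k"
      unfolding alpha_def using N act ub_u that by (intro vsum_cong) auto
    then show "vsum (cdim G i) (\<lambda>j. Nblock G i j k *\<^sub>v LCS1_action G lam mu j k) P
        = Nblock G i i k *\<^sub>v u i k + alpha i k"
      using vsum_remove[OF fin that(1),
          of "\<lambda>j. Nblock G i j k *\<^sub>v LCS1_action G lam mu j k" "cdim G i"]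
        N act that by simp
  qed
  have costate: "lam i k = Qmat G i k *\<^sub>v x k + pvec G i k + (Amat G k)\<^sup>T *\<^sub>v lam i (Suc k)
      - (Mmat G i k)\<^sup>T *\<^sub>v mu i k" if "i \<in> P" "k < K" for i k
  proof -
    have E: "E i k = (Amat G k)\<^sup>T * E i (Suc k) * Amat G k + Qmat G i k
        - (Amat G k)\<^sup>T * E i (Suc k) * Bmat G i k * Yinv G E i k
            * (Bmat G i k)\<^sup>T * E i (Suc k) * Amat G k"
      using assms(3) that unfolding riccati_solution_def P_def K_def by blast
    have e: "e i k = (Amat G k)\<^sup>T *\<^sub>v e i (Suc k) + ((Amat G k)\<^sup>T * E i (Suc k)) *\<^sub>v eta i k
        - ((Amat G k)\<^sup>T * E i (Suc k) * Bmat G i k) *\<^sub>v b i k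
        + pvec G i k - (Mmat G i k)\<^sup>T *\<^sub>v mu i k"
      unfolding mueq[OF that] by (rule LCS2_step[OF that, THEN conjunct2, THEN conjunct1])
    have "lam i k = E i k *\<^sub>v x k + e i k"
      using lam that unfolding P_def K_def by auto
    also have "\<dots> = Qmat G i k *\<^sub>v x k + pvec G i k
        + (Amat G k)\<^sup>T *\<^sub>v (E i (Suc k) *\<^sub>v x (Suc k) + e i (Suc k)) - (Mmat G i k)\<^sup>T *\<^sub>v mu i k"
      \<comment> \<open>Expressing \<open>x (Suc k)\<close> through stage \<open>k\<close> turns the
        equation into the one-stage co-state identity.\<close>
      unfolding E e state[OF that] by (rule riccati_stage.costate[OF stage[OF that]])
    also have "E i (Suc k) *\<^sub>v x (Suc k) + e i (Suc k) = lam i (Suc k)"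
      using lam[of i "Suc k"] that unfolding P_def K_def by simp
    finally show ?thesis .
  qed
  have constraint: "compl (cdim G i)
      (Mmat G i k *\<^sub>v x k + (Nblock G i i k *\<^sub>v u i k + alpha i k) + rvec G i k) (mu i k)"
    if "i \<in> P" "k < K" for i k
  proof -
    have "compl (cdim G i)
        ((Nblock G i i k * Yinv G E i k) *\<^sub>v beta G mus mu i k
         + (Mmat G i k
              - Nblock G i i k * Yinv G E i k * (Bmat G i k)\<^sup>T * E i (Suc k) * Amat G k) *\<^sub>v x k
         - Nblock G i i k *\<^sub>v b i k + alpha i k + rvec G i k)
        (mu i k)"
      by (rule LCS2_step[OF that, THEN conjunct2, THEN conjunct2, THEN conjunct1])
    then show ?thesis
      unfolding beta[OF that]
        riccati_stage.constraint[OF stage[OF that] alphac[OF that(2)] mats(4)[OF that]] .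
  qed
  have final: "lam i K = Qmat G i K *\<^sub>v x K + pvec G i K" if "i \<in> P" for i
  proof -
    have "E i K = Qmat G i K"
      using assms(3) that unfolding riccati_solution_def P_def K_def by blast
    moreover have "e i K = pvec G i K"
      using LCS2 that by blast
    ultimately show ?thesis
      using lam[of i K] that unfolding P_def K_def by simp
  qed
  have lamc: "lam i k \<in> carrier_vec n" if "i \<in> P" "k \<le> K" for i k
    using lam[of i k] that Ec[OF that] xc[OF that(2)] ec[OF that] unfolding P_def K_def by auto
  show ?thesis
    unfolding LCS1_solution_def Let_def n_def[symmetric] K_def[symmetric] P_def[symmetric]
  proof (intro conjI ballI allI impI)
    fix i k assume ik: "i \<in> P" "k < K"
    show "x (Suc k) = Amat G k *\<^sub>v x k
        + vsum n (\<lambda>j. Bmat G j k *\<^sub>v LCS1_action G lam mu j k) P"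
      unfolding sumB[OF ik] by (rule state[OF ik])
    show "compl (cdim G i) (Mmat G i k *\<^sub>v x k
        + vsum (cdim G i) (\<lambda>j. Nblock G i j k *\<^sub>v LCS1_action G lam mu j k) P
        + rvec G i k) (mu i k)"
      unfolding sumN[OF ik] by (rule constraint[OF ik])
  qed (use LCS2 in \<open>blast intro: xc lamc muc final costate\<close>)+
qed

end
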